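(* Suppose $K,E$ are variables and $q$ is an indeterminate such that $KE=q^2EK$ and $K$ is invertible. Then for any $n\ge1$, $$T_n(K+K^{-1}+E)=K^n+K^{-n}+E^n+\sum_{r=1}^{n-1}\sum_{j=0}^{n-r}c(n,r,j)\,[E^rK^{n-2j-r}],$$ where $c(n,r,j)\in\mathbb Z[q^{\pm1}]$ is given by $$c(n,r,j)=\frac{[n]_q}{[r]_q}\binom{n-j-1}{r-1}_q\binom{r+j-1}{r-1}_q,$$ and in fact $c(n,r,j)\in\mathbb N[q^{\pm1}]$. Moreover, if $q^2$ is a root of unity of order $n$, then $c(n,r,j)=0$ (for all $1\le r\le n-1$, $0\le j\le n-r$).
   Context: $T_n$ are the Chebyshev polynomials of type one: $T_0(z)=2$, $T_1(z)=z$, $T_n(z)=zT_{n-1}(z)-T_{n-2}(z)$ for $n\ge2$. Quantum integers and binomials: $[n]_q=\frac{q^n-q^{-n}}{q-q^{-1}}$ and $\binom{n}{k}_q=\prod_{j=1}^k\frac{[n-j+1]_q}{[j]_q}$. $\mathbb N[q^{\pm1}]$ denotes Laurent polynomials with non-negative integer coefficients. $[E^rK^m]$ is the Weyl normalization: if $xy=q^{C}yx$ then $[xy]=q^{-C/2}xy$; here $[E^rK^m]=q^{rm}E^rK^m$. The identity takes place in the algebra $\mathbb Z[q^{\pm1}]\langle K^{\pm1},E\rangle/(KE=q^2EK)$; in the last sentence $c(n,r,j)$ is evaluated at a number $q$ with $q^2$ a primitive $n$th root of unity. *)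

theory Defs
  imports
    Complex_Main
    "HOL-Library.Poly_Mapping"
    "HOL-Computational_Algebra.Fraction_Field"
begin

text \<open>
  The group algebra of the integers: a Laurent polynomial is the finitely supported map
  sending an exponent to its coefficient, and multiplication is convolution.
\<close>

type_synonym laurent = "int \<Rightarrow>\<^sub>0 int"

definition qpow :: "int \<Rightarrow> laurent" where
  "qpow k = Poly_Mapping.single k 1"

definition nonneg_laurent :: "laurent set" where
  "nonneg_laurent = {p. \<forall>k. 0 \<le> Poly_Mapping.lookup p k}"

definition eval_laurent :: "complex \<Rightarrow> laurent \<Rightarrow> complex" where
  "eval_laurent z p = (\<Sum>k\<in>Poly_Mapping.keys p. of_int (Poly_Mapping.lookup p k) * z powi k)"

definition to_frac :: "laurent \<Rightarrow> laurent fract" where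
  "to_frac p = Fract p 1"

definition qint :: "'a::field \<Rightarrow> int \<Rightarrow> 'a" where
  "qint q n = (q powi n - q powi (- n)) / (q - inverse q)"

text \<open>The upper argument is an integer so that no subtraction is truncated.\<close>

definition qbinom :: "'a::field \<Rightarrow> int \<Rightarrow> nat \<Rightarrow> 'a" where
  "qbinom q n k = (\<Prod>j=1..k. qint q (n - int j + 1) / qint q (int j))"

definition cheb_coeff :: "'a::field \<Rightarrow> nat \<Rightarrow> nat \<Rightarrow> nat \<Rightarrow> 'a" where
  "cheb_coeff q n r j =
     qint q (int n) / qint q (int r)
     * qbinom q (int n - int j - 1) (r - 1)
     * qbinom q (int r + int j - 1) (r - 1)"

definition has_mult_order :: "complex \<Rightarrow> nat \<Rightarrow> bool" where
  "has_mult_order w n \<longleftrightarrow> 0 < n \<and> w ^ n = 1 \<and> (\<forall>k. 0 < k \<and> k < n \<longrightarrow> w ^ k \<noteq> 1)"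

fun cheb :: "nat \<Rightarrow> 'a::ring_1 \<Rightarrow> 'a" where
  "cheb 0 z = 2"
| "cheb (Suc 0) z = z"
| "cheb (Suc (Suc n)) z = z * cheb (Suc n) z - cheb n z"

datatype gen = Gen_K | Gen_Kinv | Gen_E

datatype word = Word "gen list"

instantiation word :: monoid_add
begin

definition zero_word :: word where
  "zero_word = Word []"

fun plus_word :: "word \<Rightarrow> word \<Rightarrow> word" where
  "plus_word (Word u) (Word v) = Word (u @ v)"

instance
proof
  fix a b c :: word
  show "a + b + c = a + (b + c)"
    by (cases a; cases b; cases c) simp
  show "0 + a = a" by (cases a) (simp add: zero_word_def)
  show "a + 0 = a" by (cases a) (simp add: zero_word_def)
qed

end

text \<open>
  The monoid algebra of the free monoid, i.e. noncommutative polynomials with coefficients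
  in the Laurent polynomials. The monoid of words is written additively, as the convolution
  product of \<^typ>\<open>'a \<Rightarrow>\<^sub>0 'b\<close> requires, so that \<open>0\<close> is the empty word and addition is
  concatenation.
\<close>

type_synonym free_alg = "word \<Rightarrow>\<^sub>0 laurent"

definition free_gen :: "gen \<Rightarrow> free_alg" where
  "free_gen g = Poly_Mapping.single (Word [g]) 1"

definition free_scal :: "laurent \<Rightarrow> free_alg" where
  "free_scal c = Poly_Mapping.single 0 c"

inductive_set rel_ideal :: "free_alg set" where
  K_Kinv: "free_gen Gen_K * free_gen Gen_Kinv - 1 \<in> rel_ideal"
| Kinv_K: "free_gen Gen_Kinv * free_gen Gen_K - 1 \<in> rel_ideal"
| K_E: "free_gen Gen_K * free_gen Gen_E
        - free_scal (qpow 2) * free_gen Gen_E * free_gen Gen_K \<in> rel_ideal"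
| zero: "0 \<in> rel_ideal"
| add: "a \<in> rel_ideal \<Longrightarrow> b \<in> rel_ideal \<Longrightarrow> a + b \<in> rel_ideal"
| mult_left: "a \<in> rel_ideal \<Longrightarrow> x * a \<in> rel_ideal"
| mult_right: "a \<in> rel_ideal \<Longrightarrow> a * x \<in> rel_ideal"

lemma rel_ideal_minus: "a \<in> rel_ideal \<Longrightarrow> - a \<in> rel_ideal"
  using rel_ideal.mult_left[of a "- 1"] by simp

definition rel_eq :: "free_alg \<Rightarrow> free_alg \<Rightarrow> bool" where
  "rel_eq a b \<longleftrightarrow> a - b \<in> rel_ideal"

lemma rel_eq_equivp: "equivp rel_eq"
proof (rule equivpI)
  show "reflp rel_eq"
    by (rule reflpI) (simp add: rel_eq_def rel_ideal.zero)
  show "symp rel_eq"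
    by (rule sympI) (use rel_ideal_minus in \<open>fastforce simp: rel_eq_def\<close>)
  show "transp rel_eq"
  proof (rule transpI)
    fix a b c assume "rel_eq a b" "rel_eq b c"
    then have "(a - b) + (b - c) \<in> rel_ideal"
      unfolding rel_eq_def by (rule rel_ideal.add)
    then show "rel_eq a c" by (simp add: rel_eq_def)
  qed
qed

text \<open>
  The quotient is not the zero ring: sending \<open>E\<close> to 0 and \<open>K\<close>, its inverse to 1 annihilates
  the ideal.
\<close>

primrec word_aug :: "word \<Rightarrow> laurent" where
  "word_aug (Word u) = (if Gen_E \<in> set u then 0 else 1)"

definition free_aug :: "free_alg \<Rightarrow> laurent" where
  "free_aug a = (\<Sum>w\<in>Poly_Mapping.keys a. Poly_Mapping.lookup a w * word_aug w)"

lemma word_aug_plus: "word_aug (u + v) = word_aug u * word_aug v"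
  by (cases u; cases v) simp

lemma free_aug_superset:
  assumes "finite A" "Poly_Mapping.keys a \<subseteq> A"
  shows "free_aug a = (\<Sum>w\<in>A. Poly_Mapping.lookup a w * word_aug w)"
  unfolding free_aug_def
  by (rule sum.mono_neutral_left) (use assms in \<open>auto simp: in_keys_iff\<close>)

lemma free_aug_add: "free_aug (a + b) = free_aug a + free_aug b"
proof -
  let ?A = "Poly_Mapping.keys a \<union> Poly_Mapping.keys b"
  have "free_aug (a + b) = (\<Sum>w\<in>?A. Poly_Mapping.lookup (a + b) w * word_aug w)"
    by (rule free_aug_superset) (simp_all add: Poly_Mapping.keys_add)
  also have "\<dots> = free_aug a + free_aug b"
    by (simp add: free_aug_superset[of ?A a] free_aug_superset[of ?A b]
        lookup_add distrib_right sum.distrib)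
  finally show ?thesis .
qed

lemma free_aug_0 [simp]: "free_aug 0 = 0"
  by (simp add: free_aug_def)

lemma free_aug_single: "free_aug (Poly_Mapping.single w c) = c * word_aug w"
  by (cases "c = 0") (simp_all add: free_aug_def)

lemma free_aug_uminus: "free_aug (- a) = - free_aug a"
  using free_aug_add[of a "- a"] by (simp add: eq_neg_iff_add_eq_0 add.commute)

lemma free_aug_diff: "free_aug (a - b) = free_aug a - free_aug b"
  using free_aug_add[of a "- b"] by (simp add: free_aug_uminus)

lemma free_alg_induct [case_names zero single add]:
  assumes "P 0" "\<And>w c. P (Poly_Mapping.single w c)"
    "\<And>a b. P a \<Longrightarrow> P b \<Longrightarrow> P (a + b)"
  shows "P (a :: free_alg)"
proof (induction a rule: update_induct)
  case const
  then show ?case by (rule assms(1))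
next
  case (update f w c)
  have "Poly_Mapping.update w c f = f + Poly_Mapping.single w c"
    using update.hyps(1)
    by (intro poly_mapping_eqI) (auto simp: lookup_update lookup_add lookup_single in_keys_iff when_def)
  with update.IH assms(2,3) show ?case by simp
qed

lemma free_aug_mult: "free_aug (a * b) = free_aug a * free_aug b"
proof (induction a rule: free_alg_induct)
  case (single w c)
  show ?case
    by (induction b rule: free_alg_induct)
      (simp_all add: mult_single free_aug_single word_aug_plus free_aug_add distrib_left ac_simps)
qed (simp_all add: distrib_right free_aug_add)

lemma free_aug_1 [simp]: "free_aug 1 = 1"
proof -
  have "word_aug 0 = 1" by (simp add: zero_word_def)
  then show ?thesis using free_aug_single[of 0 1] by (simp add: single_one)
qed

lemma free_aug_rel_ideal: "a \<in> rel_ideal \<Longrightarrow> free_aug a = 0"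
  by (induction rule: rel_ideal.induct)
    (simp_all add: free_aug_diff free_aug_mult free_aug_add free_aug_single
      free_gen_def free_scal_def)

lemma one_notin_rel_ideal: "(1::free_alg) \<notin> rel_ideal"
  using free_aug_rel_ideal[of 1] by auto

quotient_type qalg = free_alg / rel_eq
  by (rule rel_eq_equivp)

instantiation qalg :: ring_1
begin

lift_definition zero_qalg :: qalg is 0 .

lift_definition one_qalg :: qalg is 1 .

lift_definition plus_qalg :: "qalg \<Rightarrow> qalg \<Rightarrow> qalg" is "(+)"
proof -
  fix a b c d assume "rel_eq a b" "rel_eq c d"
  then have "(a - b) + (c - d) \<in> rel_ideal"
    unfolding rel_eq_def by (rule rel_ideal.add)
  then show "rel_eq (a + c) (b + d)" by (simp add: rel_eq_def algebra_simps)
qed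

lift_definition uminus_qalg :: "qalg \<Rightarrow> qalg" is uminus
  using rel_ideal_minus by (fastforce simp: rel_eq_def)

lift_definition minus_qalg :: "qalg \<Rightarrow> qalg \<Rightarrow> qalg" is "(-)"
proof -
  fix a b c d assume "rel_eq a b" "rel_eq c d"
  then have "(a - b) + - (c - d) \<in> rel_ideal"
    unfolding rel_eq_def by (intro rel_ideal.add rel_ideal_minus)
  then show "rel_eq (a - c) (b - d)" by (simp add: rel_eq_def algebra_simps)
qed

lift_definition times_qalg :: "qalg \<Rightarrow> qalg \<Rightarrow> qalg" is "(*)"
proof -
  fix a b c d assume "rel_eq a b" "rel_eq c d"
  then have "(a - b) * c + b * (c - d) \<in> rel_ideal"
    unfolding rel_eq_def
    by (intro rel_ideal.add rel_ideal.mult_left rel_ideal.mult_right)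
  then show "rel_eq (a * c) (b * d)" by (simp add: rel_eq_def algebra_simps)
qed

instance
proof
  fix a b c :: qalg
  show "a + b + c = a + (b + c)"
    by transfer (simp add: rel_eq_def rel_ideal.zero algebra_simps)
  show "a + b = b + a"
    by transfer (simp add: rel_eq_def rel_ideal.zero algebra_simps)
  show "0 + a = a" by transfer (simp add: rel_eq_def rel_ideal.zero)
  show "- a + a = 0" by transfer (simp add: rel_eq_def rel_ideal.zero)
  show "a - b = a + - b" by transfer (simp add: rel_eq_def rel_ideal.zero)
  show "a * b * c = a * (b * c)"
    by transfer (simp add: rel_eq_def rel_ideal.zero algebra_simps)
  show "1 * a = a" by transfer (simp add: rel_eq_def rel_ideal.zero)
  show "a * 1 = a" by transfer (simp add: rel_eq_def rel_ideal.zero)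
  show "(a + b) * c = a * c + b * c"
    by transfer (simp add: rel_eq_def rel_ideal.zero algebra_simps)
  show "a * (b + c) = a * b + a * c"
    by transfer (simp add: rel_eq_def rel_ideal.zero algebra_simps)
  show "(0::qalg) \<noteq> 1"
    by transfer (use one_notin_rel_ideal rel_ideal_minus in \<open>fastforce simp: rel_eq_def\<close>)
qed

end

lift_definition gen_K :: qalg is "free_gen Gen_K" .

lift_definition gen_Kinv :: qalg is "free_gen Gen_Kinv" .

lift_definition gen_E :: qalg is "free_gen Gen_E" .

lift_definition scal :: "laurent \<Rightarrow> qalg" is free_scal .

definition K_powi :: "int \<Rightarrow> qalg" where
  "K_powi m = (if 0 \<le> m then gen_K ^ nat m else gen_Kinv ^ nat (- m))"

text \<open>
  The Weyl normalization of \<open>x y\<close> is \<open>q\<^bsup>-C/2\<^esup> x y\<close> when \<open>x y = q\<^bsup>C\<^esup> y x\<close>. For \<open>x = E\<^bsup>r\<^esup>\<close>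
  and \<open>y = K\<^bsup>m\<^esup>\<close> the exponent is \<open>C = -2rm\<close>; see \<open>E_power_K_powi\<close> below.
\<close>

definition weyl_EK :: "nat \<Rightarrow> int \<Rightarrow> qalg" where
  "weyl_EK r m = scal (qpow (int r * m)) * gen_E ^ r * K_powi m"

lemma K_Kinv: "gen_K * gen_Kinv = 1"
  by transfer (simp add: rel_eq_def rel_ideal.K_Kinv)

lemma Kinv_K: "gen_Kinv * gen_K = 1"
  by transfer (simp add: rel_eq_def rel_ideal.Kinv_K)

lemma K_E: "gen_K * gen_E = scal (qpow 2) * gen_E * gen_K"
  by transfer (simp add: rel_eq_def rel_ideal.K_E)

lemma free_scal_central: "free_scal c * a = a * free_scal c"
  by (induction a rule: free_alg_induct)
    (simp_all add: free_scal_def mult_single distrib_left distrib_right mult.commute)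

lemma scal_central: "scal c * x = x * scal c"
  by transfer (simp add: rel_eq_def free_scal_central rel_ideal.zero)

lemma scal_mult: "scal (c * d) = scal c * scal d"
  by transfer (simp add: rel_eq_def free_scal_def mult_single rel_ideal.zero)

lemma scal_1: "scal 1 = 1"
  by transfer (simp add: rel_eq_def free_scal_def rel_ideal.zero)

lemma scal_add: "scal (c + d) = scal c + scal d"
  by transfer (simp add: rel_eq_def free_scal_def single_add rel_ideal.zero)

lemma qpow_0: "qpow 0 = 1"
  by (simp add: qpow_def)

lemma qpow_add: "qpow (k + l) = qpow k * qpow l"
  by (simp add: qpow_def mult_single)

lemma scal_qpow_add: "scal (qpow (k + l)) = scal (qpow k) * scal (qpow l)"
  by (simp add: qpow_add scal_mult)

lemma power_q_commute:
  assumes "x * y = scal (qpow k) * y * x"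
  shows "x ^ m * y = scal (qpow (k * int m)) * y * x ^ m"
proof (induction m)
  case 0
  then show ?case by (simp add: qpow_0 scal_1)
next
  case (Suc m)
  let ?c = "scal (qpow (k * int m))"
  have "x ^ Suc m * y = x * (?c * y * x ^ m)"
    by (simp only: power_Suc mult.assoc Suc.IH[unfolded mult.assoc])
  also have "\<dots> = (x * ?c) * y * x ^ m"
    by (simp only: mult.assoc)
  also have "\<dots> = ?c * (x * y) * x ^ m"
    by (simp only: scal_central[of _ x, symmetric] mult.assoc)
  also have "\<dots> = ?c * (scal (qpow k) * y * x) * x ^ m"
    by (simp only: assms)
  also have "\<dots> = (?c * scal (qpow k)) * y * x ^ Suc m"
    by (simp only: mult.assoc power_Suc)
  also have "?c * scal (qpow k) = scal (qpow (k * int (Suc m)))"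
    by (simp add: scal_qpow_add[symmetric] algebra_simps)
  finally show ?case .
qed

lemma q_commute_flip:
  assumes "x * y = scal (qpow k) * y * x"
  shows "y * x = scal (qpow (- k)) * x * y"
proof -
  have "scal (qpow (- k)) * x * y = (scal (qpow (- k)) * scal (qpow k)) * (y * x)"
    by (simp only: mult.assoc assms)
  also have "scal (qpow (- k)) * scal (qpow k) = 1"
    by (simp add: scal_qpow_add[symmetric] qpow_0 scal_1)
  also have "1 * (y * x) = y * x" by simp
  finally show ?thesis ..
qed

lemma Kinv_E: "gen_Kinv * gen_E = scal (qpow (- 2)) * gen_E * gen_Kinv"
proof -
  have "gen_E * gen_K = scal (qpow (- 2)) * gen_K * gen_E"
    by (rule q_commute_flip[OF K_E])
  then have "gen_Kinv * (gen_E * gen_K) * gen_Kinv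
      = (gen_Kinv * scal (qpow (- 2))) * gen_K * gen_E * gen_Kinv"
    by (simp only: mult.assoc)
  also have "\<dots> = scal (qpow (- 2)) * (gen_Kinv * gen_K) * gen_E * gen_Kinv"
    by (simp only: scal_central[of _ gen_Kinv, symmetric] mult.assoc)
  also have "gen_Kinv * (gen_E * gen_K) * gen_Kinv = gen_Kinv * gen_E * (gen_K * gen_Kinv)"
    by (simp only: mult.assoc)
  finally show ?thesis
    by (simp add: K_Kinv Kinv_K)
qed

lemma K_powi_E: "K_powi m * gen_E = scal (qpow (2 * m)) * gen_E * K_powi m"
  using power_q_commute[OF K_E, of "nat m"] power_q_commute[OF Kinv_E, of "nat (- m)"]
  by (simp add: K_powi_def)

lemma E_power_K_powi:
  "gen_E ^ r * K_powi m = scal (qpow (- 2 * int r * m)) * K_powi m * gen_E ^ r"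
proof -
  have "gen_E * K_powi m = scal (qpow (- (2 * m))) * K_powi m * gen_E"
    by (rule q_commute_flip[OF K_powi_E])
  from power_q_commute[OF this, of r] show ?thesis
    by (simp add: algebra_simps)
qed

end

theory Submission
  imports Defs
begin

text \<open>
  Write \<open>n = r + a + j\<close>, so that \<open>n - 2 * j - r = a - j\<close>: the expansion runs over all ways of
  splitting \<open>n\<close> into three parts. Left multiplication by \<open>K\<close>, \<open>K\<^sup>-\<^sup>1\<close> and \<open>E\<close> sends \<open>[E\<^sup>r K\<^bsup>a-j\<^esup>]\<close> to a power of \<open>q\<close> times
  the Weyl monomial with \<open>a\<close>, \<open>j\<close> and \<open>r\<close>, respectively, raised by one. Hence the Chebyshev
  recurrence for \<open>T\<^sub>n (K + K\<^sup>-\<^sup>1 + E)\<close> becomes a scalar recurrence for the coefficients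
  \<open>S r a j = weyl_coeff r a j\<close> (\<open>weyl_coeff_rec\<close>), in which terms with a negative index are zero:

    \<open>S r a j = q\<^sup>r S r (a-1) j + q\<^bsup>-r\<^esup> S r a (j-1) + q\<^bsup>j-a\<^esup> S (r-1) a j - S r (a-1) (j-1)\<close>.

  It remains to guess the solution. The quotient in the closed formula hides both integrality and
  positivity; splitting \<open>[n] = q\<^sup>j [r + a] + q\<^bsup>-(r+a)\<^esup> [j]\<close> lets the factor \<open>[r]\<close> cancel
  separately in each of the two summands, and leaves a sum of two products of Gaussian binomials.
  This manifestly non-negative Laurent polynomial is taken as the definition of \<open>S\<close>. The closed
  formula is recovered, without denominators, in \<open>weyl_coeff_qdiff\<close>:

    \<open>S r a j * (q\<^sup>r - q\<^bsup>-r\<^esup>) = (q\<^sup>n - q\<^bsup>-n\<^esup>) * binom (r+a-1) (r-1) * binom (r+j-1) (r-1)\<close>.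

  The rest follows from this identity. Cancelling the common binomials reduces the recurrence to a
  polynomial identity in powers of \<open>q\<close> (\<open>qdiff_identity\<close>); dividing in the fraction
  field gives the stated formula; and when \<open>q\<^sup>2\<close> has order \<open>n\<close> the right-hand side vanishes while the factor \<open>q\<^sup>r - q\<^bsup>-r\<^esup>\<close> on the left does not, as \<open>0 < r < n\<close>.
\<close>

section \<open>Gaussian binomials\<close>

text \<open>
  The numerator of the quantum integer \<open>[k]\<close>. As \<open>[k] / [l] = qdiff k / qdiff l\<close>, the common
  denominator \<open>q - q\<^sup>-\<^sup>1\<close> never has to be divided out, and all of the algebra can be done in the
  integral domain of Laurent polynomials.
\<close>

definition qdiff :: "int \<Rightarrow> laurent" where
  "qdiff k = qpow k - qpow (- k)"

text \<open>
  The symmetric Gaussian binomial \<open>binom (a + k) k\<close>, given by the Pascal rule so that it is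
  a non-negative Laurent polynomial by construction.
\<close>

fun gauss :: "nat \<Rightarrow> nat \<Rightarrow> laurent" where
  "gauss a 0 = 1"
| "gauss 0 (Suc k) = 1"
| "gauss (Suc a) (Suc k) =
     qpow (int (Suc k)) * gauss a (Suc k) + qpow (- int (Suc a)) * gauss (Suc a) k"

text \<open>
  \<open>gauss (a - 1) k\<close> with the value 0, instead of a truncated subtraction, at \<open>a = 0\<close>. This is the
  convention under which \<open>gauss_pred_qdiff\<close> holds without a side condition.
\<close>

definition gauss_pred :: "nat \<Rightarrow> nat \<Rightarrow> laurent" where
  "gauss_pred a k = (case a of 0 \<Rightarrow> 0 | Suc a' \<Rightarrow> gauss a' k)"

lemma gauss_0 [simp]: "gauss 0 k = 1"
  by (cases k) simp_all

lemma qdiff_0 [simp]: "qdiff 0 = 0"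
  by (simp add: qdiff_def)

lemma qdiff_nonzero: "k > 0 \<Longrightarrow> qdiff k \<noteq> 0"
proof
  assume "k > 0" "qdiff k = 0"
  then have "Poly_Mapping.lookup (qpow k - qpow (- k)) k = 0"
    by (simp add: qdiff_def)
  with \<open>k > 0\<close> show False
    by (simp add: qpow_def lookup_minus lookup_single)
qed

text \<open>
  Additivity of quantum integers. It is behind both the Pascal rule and the splitting of \<open>[n]\<close> that
  makes the coefficients integral.
\<close>

lemma qdiff_add: "qdiff (k + l) = qpow l * qdiff k + qpow (- k) * qdiff l"
  by (simp add: qdiff_def right_diff_distrib qpow_add[symmetric] algebra_simps)

definition qfact :: "nat \<Rightarrow> laurent" where
  "qfact n = (\<Prod>i=1..n. qdiff (int i))"

lemma qfact_0 [simp]: "qfact 0 = 1"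
  by (simp add: qfact_def)

lemma qfact_Suc: "qfact (Suc n) = qfact n * qdiff (int (Suc n))"
  by (simp add: qfact_def)

lemma qfact_nonzero: "qfact n \<noteq> 0"
  unfolding qfact_def by (subst prod_zero_iff) (auto simp: qdiff_nonzero)

text \<open>
  The factorial formula, by induction along the Pascal rule: after clearing denominators the step is
  \<open>qdiff_add\<close> for \<open>a + 1\<close> and \<open>k + 1\<close>.
\<close>

lemma gauss_qfact: "gauss a k * (qfact a * qfact k) = qfact (a + k)"
proof (induction a k rule: gauss.induct)
  case (3 a k)
  have "gauss (Suc a) (Suc k) * (qfact (Suc a) * qfact (Suc k))
      = qpow (int (Suc k)) * qdiff (int (Suc a)) * (gauss a (Suc k) * (qfact a * qfact (Suc k)))
      + qpow (- int (Suc a)) * qdiff (int (Suc k)) * (gauss (Suc a) k * (qfact (Suc a) * qfact k))"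
    by (simp add: qfact_Suc algebra_simps)
  also have "\<dots> = (qpow (int (Suc k)) * qdiff (int (Suc a))
      + qpow (- int (Suc a)) * qdiff (int (Suc k))) * qfact (Suc a + k)"
    unfolding 3 by (simp add: distrib_right)
  also have "\<dots> = qfact (Suc a + Suc k)"
    unfolding qdiff_add[symmetric] by (simp add: qfact_Suc mult.commute add_ac)
  finally show ?case .
qed simp_all

text \<open>
  The absorption rules: with them, products of binomials with neighbouring arguments are brought to
  a common form without division.
\<close>

lemma gauss_Suc_left:
  "gauss (Suc a) k * qdiff (int (Suc a)) = gauss a k * qdiff (int (Suc (a + k)))"
proof -
  have "(gauss (Suc a) k * qdiff (int (Suc a))) * (qfact a * qfact k)
      = (gauss a k * qdiff (int (Suc (a + k)))) * (qfact a * qfact k)"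
    using gauss_qfact[of "Suc a" k]
      arg_cong[OF gauss_qfact[of a k], of "\<lambda>x. x * qdiff (int (Suc (a + k)))"]
    by (simp only: qfact_Suc add_Suc mult_ac)
  then show ?thesis by (simp add: qfact_nonzero)
qed

lemma gauss_Suc_right:
  "gauss a (Suc k) * qdiff (int (Suc k)) = gauss a k * qdiff (int (Suc (a + k)))"
proof -
  have "(gauss a (Suc k) * qdiff (int (Suc k))) * (qfact a * qfact k)
      = (gauss a k * qdiff (int (Suc (a + k)))) * (qfact a * qfact k)"
    using gauss_qfact[of a "Suc k"]
      arg_cong[OF gauss_qfact[of a k], of "\<lambda>x. x * qdiff (int (Suc (a + k)))"]
    by (simp only: qfact_Suc add_Suc_right mult_ac)
  then show ?thesis by (simp add: qfact_nonzero)
qed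

lemma gauss_pred_qdiff: "gauss_pred a k * qdiff (int (a + k)) = gauss a k * qdiff (int a)"
  using gauss_Suc_left by (cases a) (simp_all add: gauss_pred_def)

lemma gauss_pred_Suc_qdiff:
  "gauss_pred a (Suc k) * qdiff (int (Suc k)) = gauss a k * qdiff (int a)"
proof (cases a)
  case (Suc b)
  then show ?thesis
    using gauss_Suc_left[of b k] gauss_Suc_right[of b k] by (simp add: gauss_pred_def)
qed (simp add: gauss_pred_def)

section \<open>The coefficients\<close>

text \<open>
  The coefficient of \<open>[E\<^sup>r K\<^bsup>a-j\<^esup>]\<close> in \<open>T\<^sub>n\<close> for \<open>n = r + a + j\<close>. The row \<open>r = 0\<close> holds the terms
  \<open>K\<^sup>n + K\<^bsup>-n\<^esup>\<close>; both conditions hold at \<open>a = j = 0\<close>, which matches \<open>T\<^sub>0 = 2\<close>.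
\<close>

fun weyl_coeff :: "nat \<Rightarrow> nat \<Rightarrow> nat \<Rightarrow> laurent" where
  "weyl_coeff 0 a j = (if a = 0 then 1 else 0) + (if j = 0 then 1 else 0)"
| "weyl_coeff (Suc s) a j = qpow (int j) * gauss a (Suc s) * gauss j s
     + qpow (- int (Suc s + a)) * gauss a s * gauss_pred j (Suc s)"

text \<open>
  The closed formula with the denominator cleared. Multiplying by \<open>qdiff r\<close> turns both summands into
  multiples of the same product of binomials, with factors that add up to \<open>qdiff n\<close>.
\<close>

lemma weyl_coeff_qdiff:
  "weyl_coeff (Suc s) a j * qdiff (int (Suc s)) = qdiff (int (Suc s + a + j)) * gauss a s * gauss j s"
proof -
  have "weyl_coeff (Suc s) a j * qdiff (int (Suc s))
      = qpow (int j) * (gauss a (Suc s) * qdiff (int (Suc s))) * gauss j s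
      + qpow (- int (Suc s + a)) * gauss a s * (gauss_pred j (Suc s) * qdiff (int (Suc s)))"
    by (simp add: algebra_simps)
  also have "\<dots> = (qpow (int j) * qdiff (int (Suc s + a))
      + qpow (- int (Suc s + a)) * qdiff (int j)) * gauss a s * gauss j s"
    unfolding gauss_pred_Suc_qdiff gauss_Suc_right
    by (simp add: algebra_simps)
  also have "\<dots> = qdiff (int (Suc s + a + j)) * gauss a s * gauss j s"
    unfolding qdiff_add[symmetric] by (simp only: of_nat_add)
  finally show ?thesis .
qed

text \<open>
  Brings the coefficient with \<open>r = s\<close> over the same binomials as those with \<open>r = s + 1\<close>, so that the
  two rows can be compared. The factor \<open>qdiff s\<close> is what makes it true for \<open>s = 0\<close> as well.
\<close>

lemma weyl_coeff_qdiff_qdiff: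
  "weyl_coeff s a j * (qdiff (int (a + s)) * qdiff (int (j + s)))
    = qdiff (int (s + a + j)) * qdiff (int s) * (gauss a s * gauss j s)"
proof (cases s)
  case (Suc t)
  have "(weyl_coeff s a j * (qdiff (int (a + s)) * qdiff (int (j + s)))) * qdiff (int s)
     = (weyl_coeff (Suc t) a j * qdiff (int (Suc t))) * (qdiff (int (a + s)) * qdiff (int (j + s)))"
    by (simp add: Suc mult_ac)
  also have "\<dots> = qdiff (int (s + a + j)) * ((gauss a t * qdiff (int (Suc (a + t))))
       * (gauss j t * qdiff (int (Suc (j + t)))))"
    unfolding weyl_coeff_qdiff by (simp add: Suc mult_ac)
  also have "\<dots> = (qdiff (int (s + a + j)) * qdiff (int s) * (gauss a s * gauss j s)) * qdiff (int s)"
    unfolding gauss_Suc_right[symmetric] by (simp add: Suc mult_ac)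
  finally show ?thesis using Suc by (simp add: qdiff_nonzero)
qed simp

text \<open>
  Predecessors of an index, with the value 0 outside the range of the expansion.
\<close>

definition shift_r :: "(nat \<Rightarrow> nat \<Rightarrow> nat \<Rightarrow> laurent) \<Rightarrow> nat \<Rightarrow> nat \<Rightarrow> nat \<Rightarrow> laurent" where
  "shift_r f r a j = (case r of 0 \<Rightarrow> 0 | Suc s \<Rightarrow> f s a j)"

definition shift_a :: "(nat \<Rightarrow> nat \<Rightarrow> laurent) \<Rightarrow> nat \<Rightarrow> nat \<Rightarrow> laurent" where
  "shift_a f a j = (case a of 0 \<Rightarrow> 0 | Suc b \<Rightarrow> f b j)"

definition shift_j :: "(nat \<Rightarrow> nat \<Rightarrow> laurent) \<Rightarrow> nat \<Rightarrow> nat \<Rightarrow> laurent" where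
  "shift_j f a j = (case j of 0 \<Rightarrow> 0 | Suc i \<Rightarrow> f a i)"

lemma shift_a_coeff_qdiff:
  "shift_a (weyl_coeff (Suc s)) a j * qdiff (int (Suc s))
     = qdiff (int (s + a + j)) * gauss_pred a s * gauss j s"
  using weyl_coeff_qdiff
  by (cases a) (simp_all add: shift_a_def gauss_pred_def del: weyl_coeff.simps of_nat_Suc)

lemma shift_j_coeff_qdiff:
  "shift_j (weyl_coeff (Suc s)) a j * qdiff (int (Suc s))
     = qdiff (int (s + a + j)) * gauss a s * gauss_pred j s"
  using weyl_coeff_qdiff
  by (cases j) (simp_all add: shift_j_def gauss_pred_def del: weyl_coeff.simps of_nat_Suc)

lemma shift_aj_coeff_qdiff:
  "shift_a (shift_j (weyl_coeff (Suc s))) a j * qdiff (int (Suc s))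
     = qdiff (int (s + a + j) - 1) * gauss_pred a s * gauss_pred j s"
proof (cases a; cases j)
  fix b i assume "a = Suc b" "j = Suc i"
  moreover have "int (s + Suc b + Suc i) - 1 = int (Suc s + b + i)" by simp
  ultimately show ?thesis
    by (simp only: shift_a_def shift_j_def gauss_pred_def nat.case weyl_coeff_qdiff)
qed (simp_all add: shift_a_def shift_j_def gauss_pred_def)

text \<open>
  The scalar recurrence, with \<open>r = s + 1\<close>, after the common binomials have been cancelled. As an
  identity in \<open>q\<^sup>s\<close>, \<open>q\<^sup>a\<close>, \<open>q\<^sup>j\<close> and \<open>q\<close> it is a polynomial consequence of
  \<open>q\<^sup>k q\<^bsup>-k\<^esup> = 1\<close>.
\<close>

lemma qdiff_identity:
  fixes s a j :: int
  shows "qdiff (s + 1 + a + j) * qdiff (a + s) * qdiff (j + s)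
    = qdiff (s + a + j) * (qpow (s + 1) * qdiff a * qdiff (j + s)
        + qpow (- (s + 1)) * qdiff (a + s) * qdiff j
        + qpow (j - a) * qdiff (s + 1) * qdiff s)
      - qdiff (s + a + j - 1) * qdiff a * qdiff j"
proof -
  have inv: "qpow k * qpow (- k) = 1" for k by (simp add: qpow_add[symmetric] qpow_0)
  have expand: "qdiff (s + 1 + a + j) = qpow s * qpow 1 * qpow a * qpow j
        - qpow (- s) * qpow (- 1) * qpow (- a) * qpow (- j)"
    "qdiff (a + s) = qpow a * qpow s - qpow (- a) * qpow (- s)"
    "qdiff (j + s) = qpow j * qpow s - qpow (- j) * qpow (- s)"
    "qdiff (s + a + j) = qpow s * qpow a * qpow j - qpow (- s) * qpow (- a) * qpow (- j)"
    "qdiff (s + 1) = qpow s * qpow 1 - qpow (- s) * qpow (- 1)"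
    "qdiff (s + a + j - 1) = qpow s * qpow a * qpow j * qpow (- 1)
        - qpow (- s) * qpow (- a) * qpow (- j) * qpow 1"
    "qpow (s + 1) = qpow s * qpow 1" "qpow (- (s + 1)) = qpow (- s) * qpow (- 1)"
    "qpow (j - a) = qpow j * qpow (- a)"
    "qdiff s = qpow s - qpow (- s)" "qdiff a = qpow a - qpow (- a)" "qdiff j = qpow j - qpow (- j)"
    unfolding qdiff_def qpow_add[symmetric] by (simp_all add: algebra_simps)
  show ?thesis
    unfolding expand using inv[of s] inv[of a] inv[of j] inv[of 1] by algebra
qed

text \<open>
  Multiplying by \<open>[r] [r+a-1] [r+j-1]\<close>, up to the powers of \<open>q - q\<^sup>-\<^sup>1\<close>, makes every term a multiple
  of the same two binomials. The assumptions say that this multiplier is not zero; they fail only for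
  \<open>r = 1\<close> on the boundary.
\<close>

lemma weyl_coeff_rec_pos:
  assumes "a + s > 0" "j + s > 0"
  shows "weyl_coeff (Suc s) a j = qpow (int (Suc s)) * shift_a (weyl_coeff (Suc s)) a j
     + qpow (- int (Suc s)) * shift_j (weyl_coeff (Suc s)) a j
     + qpow (int j - int a) * weyl_coeff s a j
     - shift_a (shift_j (weyl_coeff (Suc s))) a j"
proof -
  let ?P = "gauss a s" and ?Q = "gauss j s" and ?D = "\<lambda>k. qdiff (int k)"
  let ?A = "shift_a (weyl_coeff (Suc s)) a j" and ?J = "shift_j (weyl_coeff (Suc s)) a j"
    and ?AJ = "shift_a (shift_j (weyl_coeff (Suc s))) a j"
  let ?M = "?D (Suc s) * (?D (a + s) * ?D (j + s))"
  have 1: "weyl_coeff (Suc s) a j * ?M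
      = qdiff (int s + 1 + int a + int j) * ?D (a + s) * ?D (j + s) * (?P * ?Q)"
  proof -
    have "int s + 1 + int a + int j = int (Suc s + a + j)" by simp
    then show ?thesis
      using arg_cong[OF weyl_coeff_qdiff[of s a j], of "\<lambda>x. x * (?D (a + s) * ?D (j + s))"]
      by (simp only: mult_ac)
  qed
  have 2: "?A * ?M = ?D (s + a + j) * ?D a * ?D (j + s) * (?P * ?Q)"
  proof -
    have "?A * ?M = (?A * ?D (Suc s)) * (?D (a + s) * ?D (j + s))" by (simp only: mult_ac)
    also have "\<dots> = ?D (s + a + j) * (gauss_pred a s * ?D (a + s)) * ?D (j + s) * ?Q"
      unfolding shift_a_coeff_qdiff by (simp only: mult_ac)
    finally show ?thesis unfolding gauss_pred_qdiff by (simp only: mult_ac)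
  qed
  have 3: "?J * ?M = ?D (s + a + j) * ?D (a + s) * ?D j * (?P * ?Q)"
  proof -
    have "?J * ?M = (?J * ?D (Suc s)) * (?D (a + s) * ?D (j + s))" by (simp only: mult_ac)
    also have "\<dots> = ?D (s + a + j) * (gauss_pred j s * ?D (j + s)) * ?D (a + s) * ?P"
      unfolding shift_j_coeff_qdiff by (simp only: mult_ac)
    finally show ?thesis unfolding gauss_pred_qdiff by (simp only: mult_ac)
  qed
  have 4: "weyl_coeff s a j * ?M = ?D (s + a + j) * ?D (Suc s) * ?D s * (?P * ?Q)"
    using arg_cong[OF weyl_coeff_qdiff_qdiff[of s a j], of "\<lambda>x. x * ?D (Suc s)"]
    by (simp only: mult_ac)
  have 5: "?AJ * ?M = qdiff (int (s + a + j) - 1) * ?D a * ?D j * (?P * ?Q)"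
  proof -
    have "?AJ * ?M = (?AJ * ?D (Suc s)) * (?D (a + s) * ?D (j + s))" by (simp only: mult_ac)
    also have "\<dots> = qdiff (int (s + a + j) - 1) * (gauss_pred a s * ?D (a + s))
        * (gauss_pred j s * ?D (j + s))"
      unfolding shift_aj_coeff_qdiff by (simp only: mult_ac)
    finally show ?thesis unfolding gauss_pred_qdiff by (simp only: mult_ac)
  qed
  have "(qpow (int (Suc s)) * ?A + qpow (- int (Suc s)) * ?J
     + qpow (int j - int a) * weyl_coeff s a j - ?AJ) * ?M
     = qpow (int (Suc s)) * (?A * ?M) + qpow (- int (Suc s)) * (?J * ?M)
     + qpow (int j - int a) * (weyl_coeff s a j * ?M) - ?AJ * ?M"
    by (simp only: left_diff_distrib distrib_right mult.assoc)
  also have "\<dots> = (?D (s + a + j) * (qpow (int s + 1) * ?D a * ?D (j + s)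
        + qpow (- (int s + 1)) * ?D (a + s) * ?D j
        + qpow (int j - int a) * ?D (Suc s) * ?D s)
      - qdiff (int (s + a + j) - 1) * ?D a * ?D j) * (?P * ?Q)"
    unfolding 2 3 4 5
    by (simp only: left_diff_distrib right_diff_distrib distrib_right distrib_left mult_ac of_nat_Suc add_ac)
  also have "\<dots> = weyl_coeff (Suc s) a j * ?M"
    unfolding 1 unfolding of_nat_add unfolding qdiff_identity by (simp only: of_nat_Suc add_ac)
  finally have "weyl_coeff (Suc s) a j * ?M = (qpow (int (Suc s)) * ?A + qpow (- int (Suc s)) * ?J
     + qpow (int j - int a) * weyl_coeff s a j - ?AJ) * ?M" ..
  moreover have "?D (Suc s) \<noteq> 0" "?D (a + s) \<noteq> 0" "?D (j + s) \<noteq> 0"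
    using assms by (simp_all only: qdiff_nonzero of_nat_0_less_iff zero_less_Suc not_False_eq_True)
  then have "?M \<noteq> 0" by (simp only: mult_eq_0_iff not_False_eq_True simp_thms)
  ultimately show ?thesis by (blast dest: mult_right_cancel[THEN iffD1])
qed

lemma weyl_coeff_1: "weyl_coeff (Suc 0) a j * qdiff 1 = qdiff (int (Suc (a + j)))"
  using weyl_coeff_qdiff[of 0 a j] by (simp del: weyl_coeff.simps)

text \<open>
  The bound \<open>2\<close> is sharp: the recurrence fails for \<open>r = 1\<close>, \<open>a = j = 0\<close>, because \<open>T\<^sub>0 = 2\<close>
  although \<open>T\<^sub>1 = z\<close>.
\<close>

lemma weyl_coeff_rec:
  assumes "r + a + j \<ge> 2"
  shows "weyl_coeff r a j = qpow (int r) * shift_a (weyl_coeff r) a j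
     + qpow (- int r) * shift_j (weyl_coeff r) a j
     + qpow (int j - int a) * shift_r weyl_coeff r a j
     - shift_a (shift_j (weyl_coeff r)) a j"
proof (cases r)
  case 0
  with assms show ?thesis
    by (auto simp: shift_a_def shift_j_def shift_r_def qpow_0 split: nat.splits)
next
  case (Suc s)
  show ?thesis
  proof (cases "a + s > 0 \<and> j + s > 0")
    case True
    with Suc show ?thesis
      using weyl_coeff_rec_pos[of a s j] by (simp add: shift_r_def del: weyl_coeff.simps)
  next
    case False
    then have s: "s = 0" by auto
    (* S 1 a j is [1 + a + j], and one of a and j is 0, so qdiff_add is all that is needed. *)
    have nz: "qdiff 1 \<noteq> 0" by (simp add: qdiff_nonzero)
    from False s consider b where "j = 0" "a = Suc b" | i where "a = 0" "j = Suc i"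
      using assms Suc by (cases a; cases j) auto
    then have "weyl_coeff r a j * qdiff 1 = (qpow (int r) * shift_a (weyl_coeff r) a j
     + qpow (- int r) * shift_j (weyl_coeff r) a j
     + qpow (int j - int a) * shift_r weyl_coeff r a j
     - shift_a (shift_j (weyl_coeff r)) a j) * qdiff 1"
    proof cases
      case 1
      show ?thesis
        using qdiff_add[of "int a" 1] weyl_coeff_1[of b 0] weyl_coeff_1[of a 0]
        by (simp add: 1 Suc s shift_a_def shift_j_def shift_r_def distrib_right mult.assoc add_ac
            del: weyl_coeff.simps(2))
    next
      case 2
      show ?thesis
        using qdiff_add[of 1 "int j"] weyl_coeff_1[of 0 i] weyl_coeff_1[of 0 j]
        by (simp add: 2 Suc s shift_a_def shift_j_def shift_r_def distrib_right mult.assoc add_ac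
            del: weyl_coeff.simps(2))
    qed
    then show ?thesis by (rule mult_right_cancel[OF nz, THEN iffD1])
  qed
qed

section \<open>Multiplication of Weyl monomials by the generators\<close>

lemma scal_0 [simp]: "scal 0 = 0"
  using scal_add[of 0 0] by simp

lemma scal_minus: "scal (c - d) = scal c - scal d"
  using scal_add[of "c - d" d] by (simp add: eq_diff_eq)

lemma left_mult_scal: "x * (scal c * y) = scal c * (x * y)"
  by (metis scal_central mult.assoc)

lemma K_mult_K_powi: "gen_K * K_powi m = K_powi (m + 1)"
proof (cases "m \<ge> 0")
  case True
  then show ?thesis by (simp add: K_powi_def nat_add_distrib)
next
  case False
  then obtain k where m: "m = - int (Suc k)"
    by (metis zero_le_imp_eq_int negD not_le)
  show ?thesis
    by (cases k) (simp_all add: m K_powi_def nat_add_distrib mult.assoc[symmetric] K_Kinv)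
qed

lemma Kinv_mult_K_powi: "gen_Kinv * K_powi m = K_powi (m - 1)"
proof -
  have "gen_Kinv * K_powi m = gen_Kinv * gen_K * K_powi (m - 1)"
    by (simp only: mult.assoc K_mult_K_powi diff_add_cancel)
  then show ?thesis by (simp add: Kinv_K)
qed

lemma K_powi_E_power: "K_powi m * gen_E ^ r = scal (qpow (2 * int r * m)) * gen_E ^ r * K_powi m"
  using q_commute_flip[OF E_power_K_powi[of r m]] by simp

lemma K_weyl: "gen_K * weyl_EK r m = scal (qpow (int r)) * weyl_EK r (m + 1)"
proof -
  have K: "gen_K * gen_E ^ r = scal (qpow (2 * int r)) * gen_E ^ r * gen_K"
    using K_powi_E_power[of 1 r] by (simp add: K_powi_def)
  have "gen_K * weyl_EK r m = scal (qpow (int r * m)) * (gen_K * gen_E ^ r) * K_powi m"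
    unfolding weyl_EK_def by (simp only: mult.assoc left_mult_scal)
  also have "\<dots> = (scal (qpow (int r * m)) * scal (qpow (2 * int r))) * gen_E ^ r * (gen_K * K_powi m)"
    unfolding K by (simp only: mult.assoc)
  also have "scal (qpow (int r * m)) * scal (qpow (2 * int r))
      = scal (qpow (int r)) * scal (qpow (int r * (m + 1)))"
    unfolding scal_qpow_add[symmetric] by (simp add: algebra_simps)
  finally show ?thesis unfolding weyl_EK_def K_mult_K_powi by (simp only: mult.assoc)
qed

lemma Kinv_weyl: "gen_Kinv * weyl_EK r m = scal (qpow (- int r)) * weyl_EK r (m - 1)"
proof -
  have "gen_Kinv * weyl_EK r m
      = gen_Kinv * (scal (qpow (- int r)) * (scal (qpow (int r)) * weyl_EK r (m - 1 + 1)))"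
    by (simp only: mult.assoc[symmetric] scal_qpow_add[symmetric]) (simp add: qpow_0 scal_1)
  also have "\<dots> = gen_Kinv * (scal (qpow (- int r)) * (gen_K * weyl_EK r (m - 1)))"
    by (simp only: K_weyl)
  also have "\<dots> = scal (qpow (- int r)) * ((gen_Kinv * gen_K) * weyl_EK r (m - 1))"
    by (metis scal_central mult.assoc)
  finally show ?thesis by (simp add: Kinv_K)
qed

lemma E_weyl: "gen_E * weyl_EK r m = scal (qpow (- m)) * weyl_EK (Suc r) m"
proof -
  have "gen_E * weyl_EK r m = scal (qpow (int r * m)) * gen_E ^ Suc r * K_powi m"
    unfolding weyl_EK_def by (metis scal_central mult.assoc power_Suc)
  also have "scal (qpow (int r * m)) = scal (qpow (- m)) * scal (qpow (int (Suc r) * m))"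
    unfolding scal_qpow_add[symmetric] by (simp add: algebra_simps)
  finally show ?thesis unfolding weyl_EK_def by (simp only: mult.assoc)
qed

section \<open>The Chebyshev recurrence\<close>

definition compositions :: "nat \<Rightarrow> (nat \<times> nat \<times> nat) set" where
  "compositions n = {(r, a, j). r + a + j = n}"

lemma finite_compositions [simp]: "finite (compositions n)"
  by (rule finite_subset[of _ "{..n} \<times> {..n} \<times> {..n}"]) (auto simp: compositions_def)

definition weyl_sum :: "nat \<Rightarrow> qalg" where
  "weyl_sum n = (\<Sum>(r, a, j)\<in>compositions n. scal (weyl_coeff r a j) * weyl_EK r (int a - int j))"

text \<open>
  Raising one index maps the compositions of \<open>n\<close> onto those compositions of \<open>n + 1\<close> where that
  index is positive; on the others the shifted coefficient is zero.
\<close>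

lemma sum_shift_r:
  "(\<Sum>(r, a, j)\<in>compositions (Suc n). scal (shift_r f r a j) * g r a j)
   = (\<Sum>(r, a, j)\<in>compositions n. scal (f r a j) * g (Suc r) a j)"
proof -
  let ?B = "compositions (Suc n) \<inter> {(r, a, j). r > 0}"
  have "(\<Sum>(r, a, j)\<in>compositions (Suc n). scal (shift_r f r a j) * g r a j)
    = (\<Sum>(r, a, j)\<in>?B. scal (shift_r f r a j) * g r a j)"
    by (rule sum.mono_neutral_right) (auto simp: shift_r_def split: nat.splits)
  also have "\<dots> = (\<Sum>(r, a, j)\<in>compositions n. scal (f r a j) * g (Suc r) a j)"
    by (rule sum.reindex_bij_witness[of _ "\<lambda>(r, a, j). (Suc r, a, j)" "\<lambda>(r, a, j). (r - 1, a, j)"])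
       (auto simp: compositions_def shift_r_def split: nat.splits)
  finally show ?thesis .
qed

lemma sum_shift_a:
  "(\<Sum>(r, a, j)\<in>compositions (Suc n). scal (shift_a (f r) a j) * g r a j)
   = (\<Sum>(r, a, j)\<in>compositions n. scal (f r a j) * g r (Suc a) j)"
proof -
  let ?B = "compositions (Suc n) \<inter> {(r, a, j). a > 0}"
  have "(\<Sum>(r, a, j)\<in>compositions (Suc n). scal (shift_a (f r) a j) * g r a j)
    = (\<Sum>(r, a, j)\<in>?B. scal (shift_a (f r) a j) * g r a j)"
    by (rule sum.mono_neutral_right) (auto simp: shift_a_def split: nat.splits)
  also have "\<dots> = (\<Sum>(r, a, j)\<in>compositions n. scal (f r a j) * g r (Suc a) j)"
    by (rule sum.reindex_bij_witness[of _ "\<lambda>(r, a, j). (r, Suc a, j)" "\<lambda>(r, a, j). (r, a - 1, j)"])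
       (auto simp: compositions_def shift_a_def split: nat.splits)
  finally show ?thesis .
qed

lemma sum_shift_j:
  "(\<Sum>(r, a, j)\<in>compositions (Suc n). scal (shift_j (f r) a j) * g r a j)
   = (\<Sum>(r, a, j)\<in>compositions n. scal (f r a j) * g r a (Suc j))"
proof -
  let ?B = "compositions (Suc n) \<inter> {(r, a, j). j > 0}"
  have "(\<Sum>(r, a, j)\<in>compositions (Suc n). scal (shift_j (f r) a j) * g r a j)
    = (\<Sum>(r, a, j)\<in>?B. scal (shift_j (f r) a j) * g r a j)"
    by (rule sum.mono_neutral_right) (auto simp: shift_j_def split: nat.splits)
  also have "\<dots> = (\<Sum>(r, a, j)\<in>compositions n. scal (f r a j) * g r a (Suc j))"
    by (rule sum.reindex_bij_witness[of _ "\<lambda>(r, a, j). (r, a, Suc j)" "\<lambda>(r, a, j). (r, a, j - 1)"])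
       (auto simp: compositions_def shift_j_def split: nat.splits)
  finally show ?thesis .
qed

text \<open>
  The products of the three generators with the sum for \<open>n + 1\<close>, and the sum for \<open>n\<close> itself, are all
  rewritten as sums over the compositions of \<open>n + 2\<close>, so that \<open>weyl_coeff_rec\<close> can be applied term by term.
\<close>

lemma weyl_sum_rec:
  "weyl_sum (Suc (Suc n)) = (gen_K + gen_Kinv + gen_E) * weyl_sum (Suc n) - weyl_sum n"
proof -
  let ?C = "compositions (Suc (Suc n))"
  let ?W = "\<lambda>r a j. weyl_EK r (int a - int j)"
  have K: "gen_K * weyl_sum (Suc n)
      = (\<Sum>(r, a, j)\<in>?C. scal (shift_a (\<lambda>a j. qpow (int r) * weyl_coeff r a j) a j) * ?W r a j)"
    unfolding sum_shift_a weyl_sum_def sum_distrib_left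
  proof (rule sum.cong[OF refl], clarify)
    fix r a j
    have "gen_K * (scal (weyl_coeff r a j) * ?W r a j)
        = scal (weyl_coeff r a j) * (gen_K * ?W r a j)"
      by (rule left_mult_scal)
    also have "gen_K * ?W r a j = scal (qpow (int r)) * weyl_EK r (int (Suc a) - int j)"
      unfolding K_weyl by (simp add: algebra_simps)
    finally show "gen_K * (scal (weyl_coeff r a j) * ?W r a j)
        = scal (qpow (int r) * weyl_coeff r a j) * weyl_EK r (int (Suc a) - int j)"
      by (simp only: mult.commute[of "qpow (int r)"] scal_mult mult.assoc)
  qed
  have Kinv: "gen_Kinv * weyl_sum (Suc n)
      = (\<Sum>(r, a, j)\<in>?C. scal (shift_j (\<lambda>a j. qpow (- int r) * weyl_coeff r a j) a j) * ?W r a j)"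
    unfolding sum_shift_j weyl_sum_def sum_distrib_left
  proof (rule sum.cong[OF refl], clarify)
    fix r a j
    have "gen_Kinv * (scal (weyl_coeff r a j) * ?W r a j)
        = scal (weyl_coeff r a j) * (gen_Kinv * ?W r a j)"
      by (rule left_mult_scal)
    also have "gen_Kinv * ?W r a j = scal (qpow (- int r)) * weyl_EK r (int a - int (Suc j))"
      unfolding Kinv_weyl by (simp add: algebra_simps)
    finally show "gen_Kinv * (scal (weyl_coeff r a j) * ?W r a j)
        = scal (qpow (- int r) * weyl_coeff r a j) * weyl_EK r (int a - int (Suc j))"
      by (simp only: mult.commute[of "qpow (- int r)"] scal_mult mult.assoc)
  qed
  have E: "gen_E * weyl_sum (Suc n)
      = (\<Sum>(r, a, j)\<in>?C. 
          scal (shift_r (\<lambda>r a j. qpow (int j - int a) * weyl_coeff r a j) r a j) * ?W r a j)"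
    unfolding sum_shift_r weyl_sum_def sum_distrib_left
  proof (rule sum.cong[OF refl], clarify)
    fix r a j
    have "gen_E * (scal (weyl_coeff r a j) * ?W r a j)
        = scal (weyl_coeff r a j) * (gen_E * ?W r a j)"
      by (rule left_mult_scal)
    also have "gen_E * ?W r a j = scal (qpow (int j - int a)) * weyl_EK (Suc r) (int a - int j)"
      unfolding E_weyl by (simp add: algebra_simps)
    finally show "gen_E * (scal (weyl_coeff r a j) * ?W r a j)
        = scal (qpow (int j - int a) * weyl_coeff r a j) * weyl_EK (Suc r) (int a - int j)"
      by (simp only: mult.commute[of "qpow (int j - int a)"] scal_mult mult.assoc)
  qed
  have 0: "weyl_sum n = (\<Sum>(r, a, j)\<in>?C. scal (shift_a (shift_j (weyl_coeff r)) a j) * ?W r a j)"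
    unfolding sum_shift_a sum_shift_j[where g = "\<lambda>r a j. ?W r (Suc a) j"] weyl_sum_def by simp
  have "weyl_sum (Suc (Suc n)) = (\<Sum>(r, a, j)\<in>?C.
       scal (shift_a (\<lambda>a j. qpow (int r) * weyl_coeff r a j) a j) * ?W r a j
     + scal (shift_j (\<lambda>a j. qpow (- int r) * weyl_coeff r a j) a j) * ?W r a j
     + scal (shift_r (\<lambda>r a j. qpow (int j - int a) * weyl_coeff r a j) r a j) * ?W r a j
     - scal (shift_a (shift_j (weyl_coeff r)) a j) * ?W r a j)"
    unfolding weyl_sum_def
  proof (rule sum.cong[OF refl], clarify)
    fix r a j assume "(r, a, j) \<in> ?C"
    then have "r + a + j \<ge> 2" by (simp add: compositions_def)
    note rec = weyl_coeff_rec[OF this]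
    have a: "shift_a (\<lambda>a j. qpow (int r) * weyl_coeff r a j) a j
        = qpow (int r) * shift_a (weyl_coeff r) a j"
      by (simp add: shift_a_def split: nat.splits)
    have j: "shift_j (\<lambda>a j. qpow (- int r) * weyl_coeff r a j) a j
        = qpow (- int r) * shift_j (weyl_coeff r) a j"
      by (simp add: shift_j_def split: nat.splits)
    have r: "shift_r (\<lambda>r a j. qpow (int j - int a) * weyl_coeff r a j) r a j
        = qpow (int j - int a) * shift_r weyl_coeff r a j"
      by (simp add: shift_r_def split: nat.splits)
    show "scal (weyl_coeff r a j) * ?W r a j =
       scal (shift_a (\<lambda>a j. qpow (int r) * weyl_coeff r a j) a j) * ?W r a j
     + scal (shift_j (\<lambda>a j. qpow (- int r) * weyl_coeff r a j) a j) * ?W r a j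
     + scal (shift_r (\<lambda>r a j. qpow (int j - int a) * weyl_coeff r a j) r a j) * ?W r a j
     - scal (shift_a (shift_j (weyl_coeff r)) a j) * ?W r a j"
      unfolding a j r
      by (subst rec) (simp only: scal_add scal_minus distrib_right left_diff_distrib)
  qed
  also have "\<dots> = gen_K * weyl_sum (Suc n) + gen_Kinv * weyl_sum (Suc n)
      + gen_E * weyl_sum (Suc n) - weyl_sum n"
    unfolding K Kinv E 0
    by (simp only: sum.distrib[symmetric] sum_subtractf[symmetric] case_prod_unfold)
  finally show ?thesis by (simp only: distrib_right)
qed

lemma cheb_eq_weyl_sum: "cheb n (gen_K + gen_Kinv + gen_E) = weyl_sum n"
proof (induction n rule: cheb.induct[where
      ?P = "\<lambda>n (_::qalg). cheb n (gen_K + gen_Kinv + gen_E) = weyl_sum n"])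
  case 1
  have "compositions 0 = {(0, 0, 0)}" by (auto simp: compositions_def)
  then show ?case
    by (simp add: weyl_sum_def weyl_EK_def K_powi_def qpow_0 scal_1 scal_add flip: one_add_one)
next
  case 2
  have "compositions (Suc 0) = {(0, 0, 1), (0, 1, 0), (1, 0, 0)}"
    by (auto simp: compositions_def)
  then show ?case
    by (simp add: weyl_sum_def weyl_EK_def K_powi_def qpow_0 scal_1 gauss_pred_def add_ac)
next
  case (3 n z)
  then show ?case by (simp add: weyl_sum_rec)
qed

lemma weyl_sum_rows:
  "weyl_sum n = (\<Sum>r=0..n. \<Sum>j=0..n-r. scal (weyl_coeff r (n - r - j) j)
      * weyl_EK r (int n - 2 * int j - int r))"
proof -
  have "(\<Sum>r=0..n. \<Sum>j=0..n-r. scal (weyl_coeff r (n - r - j) j)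
          * weyl_EK r (int n - 2 * int j - int r))
     = (\<Sum>(r, j)\<in>(SIGMA r:{0..n}. {0..n - r}).
         scal (weyl_coeff r (n - r - j) j)
          * weyl_EK r (int n - 2 * int j - int r))"
    by (rule sum.Sigma) auto
  also have "\<dots> = weyl_sum n"
    unfolding weyl_sum_def
    by (rule sum.reindex_bij_witness[of _ "\<lambda>(r, a, j). (r, j)" "\<lambda>(r, j). (r, n - r - j, j)"])
       (auto simp: compositions_def algebra_simps of_nat_diff)
  finally show ?thesis ..
qed

lemma weyl_coeff_0_0 [simp]: "weyl_coeff (Suc s) 0 0 = 1"
  by (simp add: gauss_pred_def qpow_0)

text \<open>
  The row \<open>r = 0\<close> contributes only at its two ends, which are distinct as \<open>n \<ge> 1\<close>, and the row
  \<open>r = n\<close> is the single term \<open>E\<^sup>n\<close>.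
\<close>

lemma weyl_sum_expand:
  assumes "n \<ge> 1"
  shows "weyl_sum n = K_powi (int n) + K_powi (- int n) + gen_E ^ n
        + (\<Sum>r=1..n-1. \<Sum>j=0..n-r. scal (weyl_coeff r (n - r - j) j)
          * weyl_EK r (int n - 2 * int j - int r))"
proof -
  let ?row = "\<lambda>r. \<Sum>j=0..n-r. scal (weyl_coeff r (n - r - j) j)
          * weyl_EK r (int n - 2 * int j - int r)"
  obtain m where n: "n = Suc m" using assms by (cases n) auto
  have r0: "?row 0 = K_powi (int n) + K_powi (- int n)"
  proof -
    have "?row 0 = (\<Sum>j\<in>{0, n}. scal (weyl_coeff 0 (n - j) j) * weyl_EK 0 (int n - 2 * int j))"
      by (simp del: weyl_coeff.simps, rule sum.mono_neutral_right) auto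
    also have "\<dots> = K_powi (int n) + K_powi (- int n)"
      using assms by (simp add: weyl_EK_def qpow_0 scal_1)
    finally show ?thesis .
  qed
  have rn: "?row n = gen_E ^ n"
    by (simp add: n weyl_EK_def K_powi_def qpow_0 scal_1 del: weyl_coeff.simps)
  have split: "sum f {0..n} = f 0 + sum f {1..n-1} + f n" for f :: "nat \<Rightarrow> qalg"
    unfolding n by (simp add: sum.atLeast_Suc_atMost add.assoc)
  have "weyl_sum n = ?row 0 + sum ?row {1..n-1} + ?row n"
    unfolding weyl_sum_rows by (rule split)
  then show ?thesis unfolding r0 rn by (simp add: add_ac)
qed

section \<open>Non-negativity\<close>

lemma nonneg_qpow: "qpow k \<in> nonneg_laurent"
  by (simp add: nonneg_laurent_def qpow_def lookup_single when_def)

lemma nonneg_0: "0 \<in> nonneg_laurent"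
  by (simp add: nonneg_laurent_def)

lemma nonneg_1: "1 \<in> nonneg_laurent"
  using nonneg_qpow[of 0] by (simp add: qpow_0)

lemma nonneg_add: "p \<in> nonneg_laurent \<Longrightarrow> p' \<in> nonneg_laurent \<Longrightarrow> p + p' \<in> nonneg_laurent"
  by (simp add: nonneg_laurent_def lookup_add)

lemma nonneg_mult: "p \<in> nonneg_laurent \<Longrightarrow> p' \<in> nonneg_laurent \<Longrightarrow> p * p' \<in> nonneg_laurent"
  by (auto simp: nonneg_laurent_def lookup_mult Sum_any.expand_set when_def
      intro!: sum_nonneg mult_nonneg_nonneg)

lemma nonneg_gauss: "gauss a k \<in> nonneg_laurent"
  by (induction a k rule: gauss.induct)
     (auto intro!: nonneg_add nonneg_mult nonneg_qpow nonneg_1)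

lemma nonneg_gauss_pred: "gauss_pred a k \<in> nonneg_laurent"
  by (cases a) (simp_all add: gauss_pred_def nonneg_0 nonneg_gauss)

lemma nonneg_weyl_coeff: "weyl_coeff r a j \<in> nonneg_laurent"
proof (cases r)
  case 0
  then show ?thesis
    using nonneg_add[OF nonneg_1 nonneg_1] by (auto intro: nonneg_0 nonneg_1)
next
  case (Suc s)
  then show ?thesis
    by (simp add: nonneg_add nonneg_mult nonneg_qpow nonneg_gauss nonneg_gauss_pred)
qed

section \<open>The closed formula in the fraction field\<close>

lemma to_frac_mult: "to_frac (p * p') = to_frac p * to_frac p'"
  by (simp add: to_frac_def)

lemma to_frac_1 [simp]: "to_frac 1 = 1"
  by (simp add: to_frac_def One_fract_def)

lemma to_frac_diff: "to_frac (p - p') = to_frac p - to_frac p'"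
  by (simp add: to_frac_def)

lemma to_frac_eq_0_iff: "to_frac p = 0 \<longleftrightarrow> p = 0"
  by (simp add: to_frac_def Zero_fract_def eq_fract)

lemma to_frac_qpow: "to_frac (qpow k) = to_frac (qpow 1) powi k"
proof -
  have nat: "to_frac (qpow (int n)) = to_frac (qpow 1) ^ n" for n
    by (induction n) (simp_all add: qpow_0 qpow_add to_frac_mult)
  have "to_frac (qpow (- int n)) = inverse (to_frac (qpow 1) ^ n)" for n
  proof -
    have "to_frac (qpow (int n)) * to_frac (qpow (- int n)) = 1"
      by (simp add: to_frac_mult[symmetric] qpow_add[symmetric] qpow_0)
    then show ?thesis unfolding nat by (rule inverse_unique[symmetric])
  qed
  with nat show ?thesis by (cases k rule: int_cases2) (simp_all add: power_int_minus)
qed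

lemma qint_ratio:
  "qint (to_frac (qpow 1)) k / qint (to_frac (qpow 1)) l = to_frac (qdiff k) / to_frac (qdiff l)"
proof -
  have "to_frac (qdiff 1) \<noteq> 0" by (simp add: to_frac_eq_0_iff qdiff_nonzero)
  then have "to_frac (qpow 1) - inverse (to_frac (qpow 1)) \<noteq> 0"
    by (simp add: qdiff_def to_frac_diff to_frac_qpow[of "-1"] power_int_minus)
  then show ?thesis
    by (simp add: qint_def qdiff_def to_frac_diff to_frac_qpow[of k] to_frac_qpow[of "-k"]
       to_frac_qpow[of l] to_frac_qpow[of "-l"])
qed

text \<open>
  Induction on \<open>k\<close> with the upper argument \<open>m\<close> kept fixed, since passing to \<open>k + 1\<close> appends one
  factor to the product. On the side of \<open>gauss\<close> this trades one unit of the first argument for one of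
  the second.
\<close>

lemma qbinom_eq_gauss: "k \<le> m \<Longrightarrow> qbinom (to_frac (qpow 1)) (int m) k = to_frac (gauss (m - k) k)"
proof (induction k)
  case (Suc k)
  obtain a where a: "m - k = Suc a" "m - Suc k = a" using Suc.prems
    by (metis Suc_diff_Suc Suc_le_lessD)
  have "gauss a (Suc k) * qdiff (int (Suc k)) = gauss (Suc a) k * qdiff (int (Suc a))"
    by (simp only: gauss_Suc_left gauss_Suc_right)
  then have eq: "to_frac (gauss a (Suc k)) * to_frac (qdiff (int (Suc k)))
      = to_frac (gauss (Suc a) k) * to_frac (qdiff (int (Suc a)))"
    by (simp only: to_frac_mult[symmetric])
  have nz: "to_frac (qdiff (int (Suc k))) \<noteq> 0"
    by (simp add: to_frac_eq_0_iff qdiff_nonzero del: of_nat_Suc)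
  let ?q = "to_frac (qpow 1)"
  have "qbinom ?q (int m) (Suc k)
     = qbinom ?q (int m) k * (qint ?q (int m - int (Suc k) + 1) / qint ?q (int (Suc k)))"
    by (simp add: qbinom_def)
  also have "int m - int (Suc k) + 1 = int (Suc a)" using a Suc.prems by simp
  also have "qbinom ?q (int m) k * (qint ?q (int (Suc a)) / qint ?q (int (Suc k)))
     = to_frac (gauss (Suc a) k) * to_frac (qdiff (int (Suc a))) / to_frac (qdiff (int (Suc k)))"
    using Suc a by (simp add: qint_ratio)
  also have "\<dots> = to_frac (gauss a (Suc k))"
    unfolding eq[symmetric] using nz by simp
  finally show ?case using a by simp
qed (simp add: qbinom_def)

lemma to_frac_weyl_coeff:
  assumes "r \<ge> 1" "r + j \<le> n"
  shows "to_frac (weyl_coeff r (n - r - j) j) = cheb_coeff (to_frac (qpow 1)) n r j"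
proof -
  obtain s where s: "r = Suc s" using assms by (cases r) auto
  define a where "a = n - r - j"
  have n: "n = Suc s + a + j" using assms by (simp add: a_def s)
  have nz: "to_frac (qdiff (int (Suc s))) \<noteq> 0"
    by (simp add: to_frac_eq_0_iff qdiff_nonzero del: of_nat_Suc)
  have "to_frac (weyl_coeff (Suc s) a j) * to_frac (qdiff (int (Suc s)))
      = to_frac (qdiff (int n)) * to_frac (gauss a s) * to_frac (gauss j s)"
    unfolding to_frac_mult[symmetric] weyl_coeff_qdiff n ..
  then have c: "to_frac (weyl_coeff (Suc s) a j)
      = to_frac (qdiff (int n)) / to_frac (qdiff (int (Suc s))) * to_frac (gauss a s) * to_frac (gauss j s)"
    using nz by (simp add: field_simps del: weyl_coeff.simps of_nat_Suc)
  have upper: "int n - int j - 1 = int (a + s)" "int (Suc s) + int j - 1 = int (j + s)"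
    by (simp_all add: n)
  show ?thesis
    unfolding a_def[symmetric]
    unfolding cheb_coeff_def qint_ratio s upper diff_Suc_1 c
    by (simp only: qbinom_eq_gauss le_add2 add_diff_cancel_right')
qed

section \<open>Vanishing at roots of unity\<close>

lemma eval_laurent_superset:
  assumes "finite A" "Poly_Mapping.keys p \<subseteq> A"
  shows "eval_laurent z p = (\<Sum>k\<in>A. of_int (Poly_Mapping.lookup p k) * z powi k)"
  unfolding eval_laurent_def
  by (rule sum.mono_neutral_left) (use assms in \<open>auto simp: in_keys_iff\<close>)

lemma eval_laurent_add: "eval_laurent z (p + p') = eval_laurent z p + eval_laurent z p'"
proof -
  let ?A = "Poly_Mapping.keys p \<union> Poly_Mapping.keys p'"
  have "eval_laurent z (p + p') = (\<Sum>k\<in>?A. of_int (Poly_Mapping.lookup (p + p') k) * z powi k)"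
    by (rule eval_laurent_superset) (simp_all add: Poly_Mapping.keys_add)
  then show ?thesis
    by (simp add: eval_laurent_superset[of ?A p] eval_laurent_superset[of ?A p']
        lookup_add distrib_right sum.distrib)
qed

lemma eval_laurent_0 [simp]: "eval_laurent z 0 = 0"
  by (simp add: eval_laurent_def)

lemma eval_laurent_single: "eval_laurent z (Poly_Mapping.single k c) = of_int c * z powi k"
  by (cases "c = 0") (simp_all add: eval_laurent_def)

lemma eval_laurent_diff: "eval_laurent z (p - p') = eval_laurent z p - eval_laurent z p'"
  using eval_laurent_add[of z "p - p'" p'] by (simp add: eq_diff_eq)

lemma laurent_induct [case_names zero single add]:
  assumes "P 0" "\<And>k c. P (Poly_Mapping.single k c)"
    "\<And>a b. P a \<Longrightarrow> P b \<Longrightarrow> P (a + b)"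
  shows "P (a :: laurent)"
proof (induction a rule: update_induct)
  case (update f k c)
  have "Poly_Mapping.update k c f = f + Poly_Mapping.single k c"
    using update.hyps(1)
    by (intro poly_mapping_eqI) (auto simp: lookup_update lookup_add lookup_single in_keys_iff when_def)
  with update.IH assms(2,3) show ?case by simp
qed (rule assms(1))

lemma eval_laurent_mult:
  assumes "z \<noteq> 0"
  shows "eval_laurent z (p * p') = eval_laurent z p * eval_laurent z p'"
proof (induction p rule: laurent_induct)
  case (single k c)
  show ?case
    by (induction p' rule: laurent_induct)
       (simp_all add: mult_single eval_laurent_single eval_laurent_add distrib_left
         power_int_add assms)
qed (simp_all add: distrib_right eval_laurent_add)

lemma eval_qdiff_eq_0_iff:
  assumes "z \<noteq> 0"
  shows "eval_laurent z (qdiff (int k)) = 0 \<longleftrightarrow> (z ^ 2) ^ k = 1"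
proof -
  have "eval_laurent z (qdiff (int k)) = z ^ k - inverse (z ^ k)"
    by (simp add: qdiff_def qpow_def eval_laurent_diff eval_laurent_single power_int_minus)
  also have "\<dots> = 0 \<longleftrightarrow> z ^ k * z ^ k = 1"
    using assms by (simp add: field_simps)
  finally show ?thesis by (simp add: power2_eq_square power_mult_distrib)
qed

lemma eval_weyl_coeff_eq_0:
  assumes "has_mult_order (z ^ 2) (r + a + j)" "r \<ge> 1" "a + j \<ge> 1"
  shows "eval_laurent z (weyl_coeff r a j) = 0"
proof -
  have z: "z \<noteq> 0" using assms(1) by (auto simp: has_mult_order_def zero_power)
  obtain s where s: "r = Suc s" using assms by (cases r) auto
  have "eval_laurent z (weyl_coeff r a j) * eval_laurent z (qdiff (int r)) = 0"
    using eval_qdiff_eq_0_iff[OF z, of "r + a + j"] assms(1) z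
    unfolding s eval_laurent_mult[OF z, symmetric] weyl_coeff_qdiff
    by (simp add: eval_laurent_mult has_mult_order_def del: of_nat_add of_nat_Suc)
  moreover have "eval_laurent z (qdiff (int r)) \<noteq> 0"
    using assms unfolding eval_qdiff_eq_0_iff[OF z] has_mult_order_def by (auto dest!: spec[of _ r])
  ultimately show ?thesis by simp
qed

theorem proposition1p3p11:
  shows "\<exists>c :: nat \<Rightarrow> nat \<Rightarrow> nat \<Rightarrow> laurent. \<forall>n\<ge>1.
    cheb n (gen_K + gen_Kinv + gen_E)
      = K_powi (int n) + K_powi (- int n) + gen_E ^ n
        + (\<Sum>r=1..n-1. \<Sum>j=0..n-r. scal (c n r j) * weyl_EK r (int n - 2 * int j - int r))
    \<and> (\<forall>r\<in>{1..n-1}. \<forall>j\<in>{0..n-r}.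
          to_frac (c n r j) = cheb_coeff (to_frac (qpow 1)) n r j
          \<and> c n r j \<in> nonneg_laurent)
    \<and> (\<forall>z::complex. has_mult_order (z ^ 2) n
          \<longrightarrow> (\<forall>r\<in>{1..n-1}. \<forall>j\<in>{0..n-r}. eval_laurent z (c n r j) = 0))"
proof (intro exI[of _ "\<lambda>n r j. weyl_coeff r (n - r - j) j"] allI impI conjI ballI)
  fix n :: nat assume n: "n \<ge> 1"
  show "cheb n (gen_K + gen_Kinv + gen_E)
      = K_powi (int n) + K_powi (- int n) + gen_E ^ n
        + (\<Sum>r=1..n-1. \<Sum>j=0..n-r. scal (weyl_coeff r (n - r - j) j)
            * weyl_EK r (int n - 2 * int j - int r))"
    unfolding cheb_eq_weyl_sum by (rule weyl_sum_expand[OF n])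
  fix r j assume rj: "r \<in> {1..n-1}" "j \<in> {0..n-r}"
  then show "to_frac (weyl_coeff r (n - r - j) j) = cheb_coeff (to_frac (qpow 1)) n r j"
    by (intro to_frac_weyl_coeff) auto
  show "weyl_coeff r (n - r - j) j \<in> nonneg_laurent" by (rule nonneg_weyl_coeff)
next
  fix n r j :: nat and z :: complex
  assume "n \<ge> 1" "has_mult_order (z ^ 2) n" "r \<in> {1..n-1}" "j \<in> {0..n-r}"
  then show "eval_laurent z (weyl_coeff r (n - r - j) j) = 0"
    by (intro eval_weyl_coeff_eq_0) auto
qed

end
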